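(* Let $N\ge 3$ and $|W_N\rangle=\frac{1}{\sqrt N}(|10\cdots0\rangle+|010\cdots0\rangle+\cdots+|0\cdots01\rangle)$. Let $\mathcal G=(V,E)$ be a graph on vertices $\{1,\dots,N\}$ and let $p_{ij}>0$ for $(i,j)\in E$. Then the random EPR distillation $|W_N\rangle\to\{p_{ij},|\Phi^{(ij)}\rangle\}_{(i,j)\in E}$ can be performed by a separable operation if and only if $$\frac{N^2}{4}\sum_{(i,j)\in E}p_{ij}^2\le 1\qquad\text{and}\qquad \frac{N}{2}\sum_{(i,j)\in E_k}p_{ij}\le 1\ \text{ for all }1\le k\le N,$$ where $E_k\subseteq E$ is the set of edges incident to vertex $k$.
   Context: A random EPR distillation $|\varphi\rangle\to\{p_{ij},|\Phi^{(ij)}\rangle\}$ of an $N$-qubit pure state means a quantum operation which, for each pair $(i,j)$, with probability $p_{ij}$ produces (up to local unitaries) a maximally entangled two-qubit state $|\Phi^{(ij)}\rangle$ shared by parties $i$ and $j$ with every other party in a pure product state; remaining outcomes are failures. The distillation configuration graph $\mathcal G$ has an edge $(i,j)$ exactly when $p_{ij}>0$. A separable operation is one with a Kraus representation $\{A_\lambda\}$, $\sum_\lambda A_\lambda^\dagger A_\lambda\le \mathbb{I}$ (failure outcomes allowed), with each $A_\lambda=M_{1,\lambda}\otimes\cdots\otimes M_{N,\lambda}$ a tensor product of single-party operators. *)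

theory Defs
  imports Complex_Main
begin

text \<open>N-qubit pure states. Parties are labelled 1..N. A computational basis
string is a function x :: nat => bool that is False outside {1..N}; an (unnormalised)
state is a function from basis strings to amplitudes (only values on Bits N matter).\<close>

definition Bits :: "nat \<Rightarrow> (nat \<Rightarrow> bool) set" where
  "Bits N = {x. \<forall>k. x k \<longrightarrow> k \<in> {1..N}}"

type_synonym qstate = "(nat \<Rightarrow> bool) \<Rightarrow> complex"

text \<open>A single-qubit operator M out in (2x2 complex matrix indexed by bool).\<close>
type_synonym op1 = "bool \<Rightarrow> bool \<Rightarrow> complex"

definition norm2 :: "nat \<Rightarrow> qstate \<Rightarrow> real" where
  "norm2 N \<psi> = (\<Sum>x\<in>Bits N. (cmod (\<psi> x))\<^sup>2)"

definition apply_local :: "nat \<Rightarrow> (nat \<Rightarrow> op1) \<Rightarrow> qstate \<Rightarrow> qstate" where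
  "apply_local N M \<psi> = (\<lambda>x. if x \<in> Bits N then
      (\<Sum>y\<in>Bits N. (\<Prod>k\<in>{1..N}. M k (x k) (y k)) * \<psi> y) else 0)"

definition unitary2 :: "op1 \<Rightarrow> bool" where
  "unitary2 U \<longleftrightarrow> (\<forall>a a'. (\<Sum>b\<in>UNIV. cnj (U b a) * U b a') = (if a = a' then 1 else 0))"

definition W_state :: "nat \<Rightarrow> qstate" where
  "W_state N = (\<lambda>x. if x \<in> Bits N \<and> card {k. x k} = 1
                     then complex_of_real (1 / sqrt (real N)) else 0)"

definition EPR_state :: "nat \<Rightarrow> nat \<Rightarrow> nat \<Rightarrow> qstate" where
  "EPR_state N i j = (\<lambda>x. if x \<in> Bits N \<and> (\<forall>k. k \<noteq> i \<and> k \<noteq> j \<longrightarrow> \<not> x k) \<and> x i = x j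
                        then complex_of_real (1 / sqrt 2) else 0)"

definition is_EPR_LU :: "nat \<Rightarrow> nat \<Rightarrow> nat \<Rightarrow> qstate \<Rightarrow> bool" where
  "is_EPR_LU N i j \<phi> \<longleftrightarrow> (\<exists>U. (\<forall>k\<in>{1..N}. unitary2 (U k)) \<and>
      (\<forall>x\<in>Bits N. \<phi> x = apply_local N U (EPR_state N i j) x))"

text \<open>The random EPR distillation psi -> {p_e, |Phi^(e)>}_{e in E} can be performed by a
separable operation: there is a finite family of product Kraus operators
A_l = A l 1 \<otimes> ... \<otimes> A l N with sum A_l^dag A_l \<le> I (Loewner order, written out as
the quadratic-form inequality), each outcome l labelled either as failure (None) or
by an edge e in E, such that every outcome labelled e yields (up to normalisation)
|Phi^(e)> up to local unitaries, and the total probability of the outcomes labelled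
e is exactly p e.\<close>
definition separable_distillation ::
  "nat \<Rightarrow> qstate \<Rightarrow> (nat \<times> nat) set \<Rightarrow> (nat \<times> nat \<Rightarrow> real) \<Rightarrow> bool" where
  "separable_distillation N \<psi> E p \<longleftrightarrow>
    (\<exists>(L :: nat set) (A :: nat \<Rightarrow> nat \<Rightarrow> op1) (lab :: nat \<Rightarrow> (nat \<times> nat) option).
       finite L \<and>
       (\<forall>\<chi>. (\<Sum>l\<in>L. norm2 N (apply_local N (A l) \<chi>)) \<le> norm2 N \<chi>) \<and>
       (\<forall>l\<in>L. \<forall>e. lab l = Some e \<longrightarrow> e \<in> E \<and>
           (\<exists>(c :: complex) \<phi>. is_EPR_LU N (fst e) (snd e) \<phi> \<and>
              (\<forall>x\<in>Bits N. apply_local N (A l) \<psi> x = c * \<phi> x))) \<and>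
       (\<forall>e\<in>E. p e = (\<Sum>l\<in>{l\<in>L. lab l = Some e}. norm2 N (apply_local N (A l) \<psi>))))"

end

theory Submission
  imports Defs "HOL-Analysis.Convex" "HOL-Library.Nat_Bijection"
begin

text \<open>
  Necessity uses only the diagonal of \<open>\<Sum> A\<^sup>\<dagger>A \<le> I\<close> at the basis states with no
  excitation, with one, and with the two excitations of an edge. Let
  \<open>A = M\<^sub>1 \<otimes> \<dots> \<otimes> M\<^sub>N\<close> map the W state to an EPR pair on \<open>i\<close>, \<open>j\<close> with probability
  \<open>2 P / N\<close>. Undoing the local unitaries, every spectator operator maps \<open>|0\<rangle>\<close> to a multiple of \<open>|0\<rangle>\<close>, so that up to
  a scalar the output is the \<open>2 \<times> 2\<close> matrix \<open>v u'\<^sup>T + u v'\<^sup>T + \<beta> u u'\<^sup>T\<close>, where \<open>u, v\<close> and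
  \<open>u', v'\<close> are the columns of \<open>M\<^sub>i\<close> and \<open>M\<^sub>j\<close>. It is a multiple of the identity, and
  comparing determinants and using Hadamard's inequality bounds \<open>P\<close> by the diagonal entries
  at \<open>1\<^sub>i\<close> and at \<open>1\<^sub>j\<close>, and \<open>P\<^sup>2\<close> by the product of those at \<open>0\<close> and at \<open>1\<^sub>i\<^sub>j\<close>. Summing the
  former gives the vertex conditions; summing the latter with the Cauchy--Schwarz inequality
  gives the quadratic one.

  Conversely, with \<open>P\<^sub>e = N p\<^sub>e / 2\<close>, one diagonal Kraus operator per edge suffices: \<open>diag(\<surd>P\<^sub>e, 1)\<close> at
  both ends of \<open>e\<close> and the projection \<open>|0\<rangle>\<langle>0|\<close> elsewhere. The sum of the squares is diagonal, with entries
  \<open>\<Sum> P\<^sub>e\<^sup>2\<close> at \<open>0\<close>, \<open>\<Sum>\<^bsub>e \<ni> k\<^esub> P\<^sub>e\<close> at \<open>1\<^sub>k\<close>, \<open>1\<close> at \<open>1\<^sub>e\<close> for each edge, and \<open>0\<close> otherwise.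
\<close>

section \<open>Product sums over bit strings\<close>

lemma Bits_0: "Bits 0 = {\<lambda>_. False}"
  by (auto simp: Bits_def)

lemma Bits_Suc: "Bits (Suc N) = Bits N \<union> (\<lambda>x. x(Suc N := True)) ` Bits N"
proof (intro equalityI subsetI)
  fix x assume x: "x \<in> Bits (Suc N)"
  show "x \<in> Bits N \<union> (\<lambda>x. x(Suc N := True)) ` Bits N"
  proof (cases "x (Suc N)")
    case True
    have "x(Suc N := False) \<in> Bits N"
      using x by (auto simp: Bits_def le_Suc_eq)
    moreover have "x = (x(Suc N := False))(Suc N := True)"
      using True by (auto simp: fun_eq_iff)
    ultimately show ?thesis by blast
  next
    case False
    then have "x \<in> Bits N"
      using x by (auto simp: Bits_def le_Suc_eq)
    then show ?thesis by blast
  qed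
qed (auto simp: Bits_def le_Suc_eq split: if_splits)

lemma Bits_beyond: "x \<in> Bits N \<Longrightarrow> k > N \<Longrightarrow> \<not> x k"
  by (auto simp: Bits_def)

lemma finite_Bits [simp]: "finite (Bits N)"
  by (induction N) (auto simp: Bits_0 Bits_Suc)

lemma Bits_update: "x \<in> Bits N \<Longrightarrow> k \<in> {1..N} \<Longrightarrow> x(k := b) \<in> Bits N"
  by (auto simp: Bits_def)

lemma Bits_single: "k \<in> {1..N} \<Longrightarrow> (\<lambda>m. m = k) \<in> Bits N"
  by (auto simp: Bits_def)

lemma Bits_eq_iff: "x \<in> Bits N \<Longrightarrow> y \<in> Bits N \<Longrightarrow> x = y \<longleftrightarrow> (\<forall>k\<in>{1..N}. x k = y k)"
proof -
  assume xy: "x \<in> Bits N" "y \<in> Bits N"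
  have "x k = y k" if "\<forall>k\<in>{1..N}. x k = y k" for k
  proof (cases "k \<in> {1..N}")
    case True
    then show ?thesis using that by blast
  next
    case False
    then have "\<not> x k" "\<not> y k" using xy unfolding Bits_def by blast+
    then show ?thesis by simp
  qed
  then show ?thesis by blast
qed

text \<open>Distributivity, by induction on the last bit. Composition of local operators and the
  norms of their images of basis states both reduce to it.\<close>

lemma sum_Bits_prod:
  fixes g :: "nat \<Rightarrow> bool \<Rightarrow> 'a::comm_ring_1"
  shows "(\<Sum>y\<in>Bits N. \<Prod>k\<in>{1..N}. g k (y k)) = (\<Prod>k\<in>{1..N}. \<Sum>b\<in>UNIV. g k b)"
proof (induction N)
  case 0
  then show ?case by (simp add: Bits_0)
next
  case (Suc N)
  let ?u = "\<lambda>x::nat \<Rightarrow> bool. x(Suc N := True)"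
  have inj: "inj_on ?u (Bits N)"
    by (rule inj_on_inverseI[where g = "\<lambda>x. x(Suc N := False)"]) (auto simp: Bits_beyond fun_eq_iff)
  have dis: "Bits N \<inter> ?u ` Bits N = {}"
    by (auto dest: Bits_beyond[of _ N "Suc N"])
  have eq: "(\<Prod>k\<in>{1..N}. g k ((?u y) k)) = (\<Prod>k\<in>{1..N}. g k (y k))" for y
    by (rule prod.cong) auto
  have "(\<Sum>y\<in>Bits (Suc N). \<Prod>k\<in>{1..Suc N}. g k (y k))
     = (\<Sum>y\<in>Bits N. \<Prod>k\<in>{1..Suc N}. g k (y k)) + (\<Sum>y\<in>Bits N. \<Prod>k\<in>{1..Suc N}. g k ((?u y) k))"
    unfolding Bits_Suc using dis inj by (subst sum.union_disjoint) (auto simp: sum.reindex o_def)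
  also have "(\<Sum>y\<in>Bits N. \<Prod>k\<in>{1..Suc N}. g k (y k)) = (\<Sum>y\<in>Bits N. (\<Prod>k\<in>{1..N}. g k (y k)) * g (Suc N) False)"
    by (rule sum.cong) (auto simp: prod.nat_ivl_Suc' Bits_beyond mult.commute)
  also have "(\<Sum>y\<in>Bits N. \<Prod>k\<in>{1..Suc N}. g k ((?u y) k)) = (\<Sum>y\<in>Bits N. (\<Prod>k\<in>{1..N}. g k (y k)) * g (Suc N) True)"
    using eq by (intro sum.cong) (auto simp: prod.nat_ivl_Suc' mult.commute)
  also have "(\<Sum>y\<in>Bits N. (\<Prod>k\<in>{1..N}. g k (y k)) * g (Suc N) False)
      + (\<Sum>y\<in>Bits N. (\<Prod>k\<in>{1..N}. g k (y k)) * g (Suc N) True)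
      = (\<Prod>k\<in>{1..N}. \<Sum>b\<in>UNIV. g k b) * (\<Sum>b\<in>UNIV. g (Suc N) b)"
    unfolding sum_distrib_right[symmetric] Suc.IH by (simp add: UNIV_bool distrib_left)
  finally show ?case by simp
qed

section \<open>Local operators\<close>

definition basis :: "(nat \<Rightarrow> bool) \<Rightarrow> qstate" where
  "basis y = (\<lambda>x. if x = y then 1 else 0)"

lemma norm2_basis: "y \<in> Bits N \<Longrightarrow> norm2 N (basis y) = 1"
proof -
  assume "y \<in> Bits N"
  moreover have "(cmod (basis y x))\<^sup>2 = (if x = y then 1 else 0)" for x
    by (simp add: basis_def)
  ultimately show ?thesis by (simp add: norm2_def)
qed

lemma apply_local_basis:
  assumes "x \<in> Bits N" "y \<in> Bits N"
  shows "apply_local N M (basis y) x = (\<Prod>k\<in>{1..N}. M k (x k) (y k))"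
proof -
  have "(\<Prod>k\<in>{1..N}. M k (x k) (z k)) * basis y z = (if z = y then (\<Prod>k\<in>{1..N}. M k (x k) (y k)) else 0)" for z
    by (simp add: basis_def)
  then show ?thesis using assms by (simp add: apply_local_def)
qed

text \<open>The image is a product vector, so its squared norm is a product of squared column norms.
  This number is the diagonal entry at \<open>y\<close> of \<open>A\<^sup>\<dagger>A\<close>, with
  \<open>A\<close> the tensor product of the \<open>M k\<close>.\<close>

lemma norm2_apply_basis:
  assumes "y \<in> Bits N"
  shows "norm2 N (apply_local N M (basis y)) = (\<Prod>k\<in>{1..N}. \<Sum>b\<in>UNIV. (cmod (M k b (y k)))\<^sup>2)"
proof -
  have "norm2 N (apply_local N M (basis y)) = (\<Sum>x\<in>Bits N. \<Prod>k\<in>{1..N}. (cmod (M k (x k) (y k)))\<^sup>2)"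
    using assms unfolding norm2_def
    by (intro sum.cong) (auto simp: apply_local_basis prod_norm[symmetric] prod_power_distrib)
  then show ?thesis by (simp only: sum_Bits_prod[of "\<lambda>k b. (cmod (M k b (y k)))\<^sup>2"])
qed

definition op_comp :: "op1 \<Rightarrow> op1 \<Rightarrow> op1" where
  "op_comp V M = (\<lambda>a c. \<Sum>b\<in>UNIV. V a b * M b c)"

definition adj :: "op1 \<Rightarrow> op1" where
  "adj U = (\<lambda>a b. cnj (U b a))"

lemma apply_local_cong:
  "(\<And>x. x \<in> Bits N \<Longrightarrow> \<psi> x = \<psi>' x) \<Longrightarrow> apply_local N M \<psi> = apply_local N M \<psi>'"
  by (auto simp: apply_local_def intro!: ext sum.cong)

lemma apply_local_scale:
  "apply_local N M (\<lambda>x. c * \<psi> x) = (\<lambda>x. c * apply_local N M \<psi> x)"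
  by (auto simp: apply_local_def sum_distrib_left algebra_simps intro!: ext sum.cong)

lemma apply_local_comp:
  "apply_local N V (apply_local N M \<psi>) = apply_local N (\<lambda>k. op_comp (V k) (M k)) \<psi>"
proof
  fix x
  show "apply_local N V (apply_local N M \<psi>) x = apply_local N (\<lambda>k. op_comp (V k) (M k)) \<psi> x"
  proof (cases "x \<in> Bits N")
    case True
    have "apply_local N V (apply_local N M \<psi>) x
        = (\<Sum>y\<in>Bits N. \<Sum>z\<in>Bits N. (\<Prod>k\<in>{1..N}. V k (x k) (y k) * M k (y k) (z k)) * \<psi> z)"
      using True by (simp add: apply_local_def prod.distrib sum_distrib_left mult.assoc)
    also have "\<dots> = (\<Sum>z\<in>Bits N. (\<Sum>y\<in>Bits N. \<Prod>k\<in>{1..N}. V k (x k) (y k) * M k (y k) (z k)) * \<psi> z)"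
      by (subst sum.swap) (simp add: sum_distrib_right)
    also have "\<dots> = (\<Sum>z\<in>Bits N. (\<Prod>k\<in>{1..N}. op_comp (V k) (M k) (x k) (z k)) * \<psi> z)"
      by (subst sum_Bits_prod[of "\<lambda>k b. V k (x k) b * M k b (_ k)"]) (simp add: op_comp_def)
    finally show ?thesis using True by (simp add: apply_local_def)
  qed (simp add: apply_local_def)
qed

lemma prod_delta_Bits:
  assumes "x \<in> Bits N" "y \<in> Bits N"
  shows "(\<Prod>k\<in>{1..N}. if x k = y k then f k else (0::'a::idom)) = (if x = y then (\<Prod>k\<in>{1..N}. f k) else 0)"
  using Bits_eq_iff[OF assms] by (auto simp: prod_zero_iff)

lemma apply_local_diag:
  assumes "x \<in> Bits N"
  shows "apply_local N (\<lambda>k a b. if a = b then D k a else 0) \<psi> x = (\<Prod>k\<in>{1..N}. D k (x k)) * \<psi> x"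
proof -
  have "apply_local N (\<lambda>k a b. if a = b then D k a else 0) \<psi> x
      = (\<Sum>y\<in>Bits N. (if x = y then (\<Prod>k\<in>{1..N}. D k (x k)) else 0) * \<psi> y)"
    using assms unfolding apply_local_def by (simp only: if_True prod_delta_Bits cong: sum.cong)
  also have "\<dots> = (\<Sum>y\<in>Bits N. if x = y then (\<Prod>k\<in>{1..N}. D k (x k)) * \<psi> x else 0)"
    by (rule sum.cong) auto
  finally show ?thesis using assms by simp
qed

lemma apply_local_unit:
  assumes "\<And>k. k \<in> {1..N} \<Longrightarrow> M k = (\<lambda>a b. if a = b then 1 else 0)" "x \<in> Bits N"
  shows "apply_local N M \<psi> x = \<psi> x"
proof -
  have "apply_local N M \<psi> x = apply_local N (\<lambda>k a b. if a = b then 1 else 0) \<psi> x"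
    using assms unfolding apply_local_def by (auto intro!: sum.cong prod.cong)
  then show ?thesis using apply_local_diag[OF assms(2), of "\<lambda>_ _. 1"] by simp
qed

lemma unitary2_adj_comp: "unitary2 U \<Longrightarrow> op_comp (adj U) U = (\<lambda>a b. if a = b then 1 else 0)"
  by (auto simp: unitary2_def op_comp_def adj_def)

text \<open>The hypotheses give a left inverse with rows \<open>(a', c')\<close> and
  \<open>(b', d')\<close>, the layout of an adjoint. Its determinant is inverse to \<open>D\<close>,
  so the matrix is \<open>D\<close> times the adjugate of the left inverse, and this makes the
  inverse two-sided.\<close>

lemma left_inverse_2x2_right:
  fixes a b c d a' b' c' d' :: "'a::comm_ring_1"
  assumes "a' * a + c' * c = 1" "a' * b + c' * d = 0" "b' * a + d' * c = 0" "b' * b + d' * d = 1"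
  shows "a * a' + b * b' = 1" "a * c' + b * d' = 0" "c * a' + d * b' = 0" "c * c' + d * d' = 1"
proof -
  define D where "D = a * d - b * c"
  have "(a' * a + c' * c) * (b' * b + d' * d) - (a' * b + c' * d) * (b' * a + d' * c) = D * (a' * d' - b' * c')"
    unfolding D_def by (simp add: algebra_simps)
  then have DD: "D * (a' * d' - b' * c') = 1" using assms by simp
  have "D * a' = (a' * a + c' * c) * d - (a' * b + c' * d) * c"
    unfolding D_def by (simp add: algebra_simps)
  then have d: "d = D * a'" using assms by simp
  have "D * b' = (b' * a + d' * c) * d - (b' * b + d' * d) * c"
    unfolding D_def by (simp add: algebra_simps)
  then have c: "c = - (D * b')" using assms by simp
  have "D * c' = (a' * b + c' * d) * a - (a' * a + c' * c) * b"
    unfolding D_def by (simp add: algebra_simps)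
  then have b: "b = - (D * c')" using assms by simp
  have "D * d' = (b' * b + d' * d) * a - (b' * a + d' * c) * b"
    unfolding D_def by (simp add: algebra_simps)
  then have a: "a = D * d'" using assms by simp
  have eqs: "D * d' * a' + - (D * c') * b' = 1" "D * d' * c' + - (D * c') * d' = 0"
    "- (D * b') * a' + D * a' * b' = 0" "- (D * b') * c' + D * a' * d' = 1"
    using DD by (simp_all add: algebra_simps)
  show "a * a' + b * b' = 1" using eqs(1) a b by metis
  show "a * c' + b * d' = 0" using eqs(2) a b by metis
  show "c * a' + d * b' = 0" using eqs(3) c d by metis
  show "c * c' + d * d' = 1" using eqs(4) c d by metis
qed

lemma unitary2_comp_adj:
  assumes "unitary2 U"
  shows "op_comp U (adj U) = (\<lambda>a b. if a = b then 1 else 0)"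
proof -
  have u: "(\<Sum>b\<in>UNIV. cnj (U b a) * U b a') = (if a = a' then 1 else 0)" for a a'
    using assms by (simp add: unitary2_def)
  have 1: "cnj (U False False) * U False False + cnj (U True False) * U True False = 1"
    "cnj (U False False) * U False True + cnj (U True False) * U True True = 0"
    "cnj (U False True) * U False False + cnj (U True True) * U True False = 0"
    "cnj (U False True) * U False True + cnj (U True True) * U True True = 1"
    using u[of False False] u[of False True] u[of True False] u[of True True]
    by (simp_all add: UNIV_bool add.commute)
  note 2 = left_inverse_2x2_right[OF 1]
  have "op_comp U (adj U) a b = (if a = b then 1 else 0)" for a b
    using 2 by (cases a; cases b) (simp_all add: op_comp_def adj_def UNIV_bool add.commute)
  then show ?thesis by blast
qed

text \<open>The adjoint moves across the inner product and cancels against \<open>U\<close>. Hence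
  local unitaries can be undone after a Kraus operator without changing any norm.\<close>

lemma norm2_unitary:
  assumes "\<And>k. k \<in> {1..N} \<Longrightarrow> unitary2 (U k)"
  shows "norm2 N (apply_local N U \<psi>) = norm2 N \<psi>"
proof -
  have "complex_of_real (norm2 N (apply_local N U \<psi>))
      = (\<Sum>x\<in>Bits N. apply_local N U \<psi> x * cnj (apply_local N U \<psi> x))"
    by (simp only: norm2_def of_real_sum complex_norm_square)
  also have "\<dots> = (\<Sum>x\<in>Bits N. \<Sum>y\<in>Bits N. (\<Prod>k\<in>{1..N}. U k (x k) (y k)) * \<psi> y * cnj (apply_local N U \<psi> x))"
    by (simp add: apply_local_def sum_distrib_right)
  also have "\<dots> = (\<Sum>y\<in>Bits N. \<psi> y * cnj (\<Sum>x\<in>Bits N. (\<Prod>k\<in>{1..N}. adj (U k) (y k) (x k)) * apply_local N U \<psi> x))"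
    by (subst sum.swap) (simp add: sum_distrib_left adj_def algebra_simps)
  also have "\<dots> = (\<Sum>y\<in>Bits N. \<psi> y * cnj (apply_local N (\<lambda>k. adj (U k)) (apply_local N U \<psi>) y))"
    by (rule sum.cong) (auto simp: apply_local_def)
  also have "\<dots> = (\<Sum>y\<in>Bits N. \<psi> y * cnj (\<psi> y))"
    unfolding apply_local_comp
    by (intro sum.cong refl, subst apply_local_unit) (use assms in \<open>simp_all add: unitary2_adj_comp\<close>)
  also have "\<dots> = complex_of_real (norm2 N \<psi>)"
    by (simp only: norm2_def of_real_sum complex_norm_square)
  finally show ?thesis by (simp only: of_real_eq_iff)
qed

lemma unitary2_adj: "unitary2 U \<Longrightarrow> unitary2 (adj U)"
  using unitary2_comp_adj[of U]
  by (auto simp: unitary2_def op_comp_def adj_def fun_eq_iff)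

section \<open>The W state under local operators\<close>

lemma W_support:
  assumes "x \<in> Bits N"
  shows "card {k. x k} = 1 \<longleftrightarrow> (\<exists>k\<in>{1..N}. x = (\<lambda>m. m = k))"
proof
  assume "card {k. x k} = 1"
  then obtain k where k: "{k. x k} = {k}" using card_1_singletonE by blast
  then have "x = (\<lambda>m. m = k)" by (auto simp: fun_eq_iff)
  moreover have "k \<in> {1..N}" using k assms unfolding Bits_def by blast
  ultimately show "\<exists>k\<in>{1..N}. x = (\<lambda>m. m = k)" by blast
qed auto

lemma sum_W_state:
  "(\<Sum>y\<in>Bits N. f y * W_state N y) = complex_of_real (1 / sqrt (real N)) * (\<Sum>k\<in>{1..N}. f (\<lambda>m. m = k))"
proof -
  let ?S = "(\<lambda>k m. m = k) ` {1..N}"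
  have inj: "inj_on (\<lambda>k m. m = k) {1..N}"
    by (rule inj_onI) (drule fun_cong, blast)
  have "(\<Sum>y\<in>Bits N. f y * W_state N y) = (\<Sum>y\<in>?S. f y * complex_of_real (1 / sqrt (real N)))"
    by (rule sum.mono_neutral_cong_right)
      (use W_support in \<open>auto simp: W_state_def Bits_single\<close>)
  also have "\<dots> = (\<Sum>k\<in>{1..N}. f (\<lambda>m. m = k) * complex_of_real (1 / sqrt (real N)))"
    by (subst sum.reindex[OF inj]) simp
  finally show ?thesis by (simp add: sum_distrib_left mult.commute)
qed

text \<open>The image of the W state without its factor \<open>1 / sqrt N\<close>. The term for
  \<open>k\<close> comes from the string excited only at \<open>k\<close>, whose bit at
  \<open>m\<close> is \<open>m = k\<close>.\<close>

definition W_image :: "nat \<Rightarrow> (nat \<Rightarrow> op1) \<Rightarrow> qstate" where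
  "W_image N B x = (\<Sum>k\<in>{1..N}. \<Prod>m\<in>{1..N}. B m (x m) (m = k))"

lemma apply_local_W:
  "x \<in> Bits N \<Longrightarrow> apply_local N B (W_state N) x = complex_of_real (1 / sqrt (real N)) * W_image N B x"
  unfolding apply_local_def W_image_def sum_W_state by simp

lemma prod_split2:
  assumes "finite S" "i \<in> S" "j \<in> S" "i \<noteq> j"
  shows "prod f S = f i * f j * prod f (S - {i, j})"
proof -
  have "S - {i, j} = S - {i} - {j}" by blast
  then show ?thesis
    using assms by (simp add: prod.remove[of S i] prod.remove[of "S - {i}" j] mult.assoc)
qed

lemma sum_split2:
  assumes "finite S" "i \<in> S" "j \<in> S" "i \<noteq> j"
  shows "sum f S = f i + f j + sum f (S - {i, j})"
proof -
  have "S - {i, j} = S - {i} - {j}" by blast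
  then show ?thesis
    using assms by (simp add: sum.remove[of S i] sum.remove[of "S - {i}" j] add.assoc)
qed

text \<open>Separates the input excitation at \<open>k\<close> from those elsewhere, so that
  \<open>x k\<close> enters only through entries of \<open>B k\<close>.\<close>

lemma W_image_split:
  assumes "k \<in> {1..N}"
  shows "W_image N B x = B k (x k) True * (\<Prod>m\<in>{1..N} - {k}. B m (x m) False)
     + B k (x k) False * (\<Sum>l\<in>{1..N} - {k}. \<Prod>m\<in>{1..N} - {k}. B m (x m) (m = l))"
proof -
  have s: "(\<Prod>m\<in>{1..N}. B m (x m) (m = l)) = B k (x k) (k = l) * (\<Prod>m\<in>{1..N} - {k}. B m (x m) (m = l))" for l
    using assms by (simp add: prod.remove)
  have "(\<Prod>m\<in>{1..N} - {k}. B m (x m) (m = k)) = (\<Prod>m\<in>{1..N} - {k}. B m (x m) False)"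
    by (rule prod.cong) auto
  then have "W_image N B x = B k (x k) True * (\<Prod>m\<in>{1..N} - {k}. B m (x m) False)
     + (\<Sum>l\<in>{1..N} - {k}. B k (x k) (k = l) * (\<Prod>m\<in>{1..N} - {k}. B m (x m) (m = l)))"
    unfolding W_image_def s using assms by (simp add: sum.remove[of _ k])
  also have "(\<Sum>l\<in>{1..N} - {k}. B k (x k) (k = l) * (\<Prod>m\<in>{1..N} - {k}. B m (x m) (m = l)))
     = (\<Sum>l\<in>{1..N} - {k}. B k (x k) False * (\<Prod>m\<in>{1..N} - {k}. B m (x m) (m = l)))"
    by (rule sum.cong) auto
  finally show ?thesis by (simp add: sum_distrib_left)
qed

text \<open>The amplitudes of a product vector have vanishing 2x2 minors; \<open>i\<close> and
  \<open>j\<close> are the two bits varied.\<close>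

lemma prod_rectangle:
  fixes f :: "nat \<Rightarrow> bool \<Rightarrow> complex"
  assumes "i \<noteq> j"
  shows "(\<Prod>m\<in>S. f m False) * (\<Prod>m\<in>S. f m (m = i \<or> m = j)) = (\<Prod>m\<in>S. f m (m = i)) * (\<Prod>m\<in>S. f m (m = j))"
proof -
  have "f m False * f m (m = i \<or> m = j) = f m (m = i) * f m (m = j)" for m
    using assms by (cases "m = i"; cases "m = j") simp_all
  then show ?thesis unfolding prod.distrib[symmetric] by simp
qed

section \<open>Local images of the W state that are EPR pairs\<close>

text \<open>Lagrange's identity: the gap between the two sides is the squared modulus of the inner
  product of the two vectors.\<close>

lemma hadamard2:
  "(cmod (v0 * u1 - v1 * u0))\<^sup>2 \<le> ((cmod u0)\<^sup>2 + (cmod u1)\<^sup>2) * ((cmod v0)\<^sup>2 + (cmod v1)\<^sup>2)"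
proof -
  have "complex_of_real ((cmod u0)\<^sup>2 + (cmod u1)\<^sup>2) * complex_of_real ((cmod v0)\<^sup>2 + (cmod v1)\<^sup>2)
    = complex_of_real ((cmod (v0 * u1 - v1 * u0))\<^sup>2 + (cmod (u0 * cnj v0 + u1 * cnj v1))\<^sup>2)"
    unfolding of_real_add complex_norm_square by (simp add: algebra_simps)
  then have "((cmod u0)\<^sup>2 + (cmod u1)\<^sup>2) * ((cmod v0)\<^sup>2 + (cmod v1)\<^sup>2)
    = (cmod (v0 * u1 - v1 * u0))\<^sup>2 + (cmod (u0 * cnj v0 + u1 * cnj v1))\<^sup>2"
    by (simp only: of_real_mult[symmetric] of_real_eq_iff)
  then show ?thesis by simp
qed

definition vnorm2 :: "(bool \<Rightarrow> complex) \<Rightarrow> real" where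
  "vnorm2 u = (\<Sum>b\<in>UNIV. (cmod (u b))\<^sup>2)"

lemma vnorm2_alt: "vnorm2 u = (cmod (u False))\<^sup>2 + (cmod (u True))\<^sup>2"
  by (simp add: vnorm2_def UNIV_bool)

lemma vnorm2_cols:
  "(\<Sum>b\<in>UNIV. (cmod (M b c))\<^sup>2) = vnorm2 (\<lambda>b. M b c)"
  by (simp add: vnorm2_def)

section \<open>Estimates for a 2x2 output matrix that is a multiple of the identity\<close>

context
  fixes Q \<beta> \<gamma> :: complex and u v u' v' :: "bool \<Rightarrow> complex"
  assumes eq: "\<And>a b. Q * (v a * u' b + u a * v' b) + \<beta> * (u a * u' b) = (if a = b then \<gamma> else 0)"
    and \<gamma>: "\<gamma> \<noteq> 0"
begin

private abbreviation (input) det where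
  "det f g \<equiv> g False * f True - g True * f False"

text \<open>The left side of \<open>eq\<close> factors into the matrix with columns
  \<open>u\<close>, \<open>v\<close>, the matrix with rows \<open>(\<beta>, Q)\<close> and
  \<open>(Q, 0)\<close>, and the transpose of the matrix with columns \<open>u'\<close>,
  \<open>v'\<close>. The middle determinant is \<open>- Q\<^sup>2\<close>, so \<beta> drops
  out.\<close>

lemma det_relation: "\<gamma>\<^sup>2 = - Q\<^sup>2 * det u v * det u' v'"
proof -
  note e = eq[of False False] eq[of False True] eq[of True False] eq[of True True]
  have "\<gamma>\<^sup>2 = (Q * (v False * u' False + u False * v' False) + \<beta> * (u False * u' False))
      * (Q * (v True * u' True + u True * v' True) + \<beta> * (u True * u' True))
    - (Q * (v False * u' True + u False * v' True) + \<beta> * (u False * u' True))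
      * (Q * (v True * u' False + u True * v' False) + \<beta> * (u True * u' False))"
    unfolding e by (simp add: power2_eq_square)
  also have "\<dots> = - Q\<^sup>2 * det u v * det u' v'"
    by (simp add: algebra_simps power2_eq_square)
  finally show ?thesis .
qed

text \<open>A multiple of a unitary scales all vectors equally; here it is applied to the
  vector orthogonal to \<open>u'\<close>.\<close>

lemma column_relation:
  "(cmod \<gamma>)\<^sup>2 * vnorm2 u' = (cmod Q)\<^sup>2 * vnorm2 u * (cmod (det u' v'))\<^sup>2"
proof -
  note e = eq[of False False] eq[of False True] eq[of True False] eq[of True True]
  have 1: "\<gamma> * u' True = Q * u False * det u' v'"
  proof -
    have "\<gamma> * u' True = (Q * (v False * u' False + u False * v' False) + \<beta> * (u False * u' False)) * u' True
      - (Q * (v False * u' True + u False * v' True) + \<beta> * (u False * u' True)) * u' False"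
      unfolding e by simp
    then show ?thesis by (simp add: algebra_simps)
  qed
  have 2: "- \<gamma> * u' False = Q * u True * det u' v'"
  proof -
    have "- \<gamma> * u' False = (Q * (v True * u' False + u True * v' False) + \<beta> * (u True * u' False)) * u' True
      - (Q * (v True * u' True + u True * v' True) + \<beta> * (u True * u' True)) * u' False"
      unfolding e by simp
    then show ?thesis by (simp add: algebra_simps)
  qed
  have "(cmod \<gamma>)\<^sup>2 * vnorm2 u' = (cmod (\<gamma> * u' True))\<^sup>2 + (cmod (- \<gamma> * u' False))\<^sup>2"
    by (simp add: vnorm2_alt norm_mult power_mult_distrib algebra_simps)
  also have "\<dots> = (cmod Q)\<^sup>2 * vnorm2 u * (cmod (det u' v'))\<^sup>2"
    unfolding 1 2 by (simp only: vnorm2_alt norm_mult power_mult_distrib distrib_left distrib_right)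
  finally show ?thesis .
qed

text \<open>Hadamard's inequality bounds the determinant in \<open>column_relation\<close> by
  \<open>vnorm2 u' * vnorm2 v'\<close>, and \<open>vnorm2 u'\<close> cancels: it is positive because
  \<open>det_relation\<close> excludes \<open>u' = 0\<close>.\<close>

lemma weight_le_single: "(cmod \<gamma>)\<^sup>2 \<le> (cmod Q)\<^sup>2 * vnorm2 u * vnorm2 v'"
proof -
  have "vnorm2 u' > 0"
  proof (rule ccontr)
    assume "\<not> vnorm2 u' > 0"
    then have "u' False = 0" "u' True = 0"
      by (auto simp: vnorm2_alt sum_power2_gt_zero_iff)
    then show False using det_relation \<gamma> by simp
  qed
  moreover have "(cmod \<gamma>)\<^sup>2 * vnorm2 u' \<le> (cmod Q)\<^sup>2 * vnorm2 u * (vnorm2 u' * vnorm2 v')"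
    unfolding column_relation unfolding vnorm2_alt
    by (intro mult_left_mono hadamard2) simp
  ultimately show ?thesis by (simp add: algebra_simps)
qed

text \<open>Hadamard's inequality for both determinants in \<open>det_relation\<close>. The factors
  are regrouped so that \<open>u\<close>, \<open>u'\<close> form the diagonal entry with no
  excitation and \<open>v\<close>, \<open>v'\<close> the one with both ends excited.\<close>

lemma weight_squared_le:
  "((cmod \<gamma>)\<^sup>2)\<^sup>2 \<le> ((cmod Q)\<^sup>2 * vnorm2 u * vnorm2 u') * ((cmod Q)\<^sup>2 * vnorm2 v * vnorm2 v')"
proof -
  have "cmod (\<gamma>\<^sup>2) = (cmod Q)\<^sup>2 * (cmod (det u v)) * (cmod (det u' v'))"
    unfolding det_relation by (simp only: norm_mult norm_minus_cancel norm_power)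
  then have "((cmod \<gamma>)\<^sup>2)\<^sup>2 = ((cmod Q)\<^sup>2)\<^sup>2 * ((cmod (det u v))\<^sup>2 * (cmod (det u' v'))\<^sup>2)"
    by (simp only: norm_power power_mult_distrib mult.assoc)
  also have "\<dots> \<le> ((cmod Q)\<^sup>2)\<^sup>2 * ((vnorm2 u * vnorm2 v) * (vnorm2 u' * vnorm2 v'))"
    unfolding vnorm2_alt by (intro mult_left_mono mult_mono hadamard2) simp_all
  finally show ?thesis by (simp add: power2_eq_square algebra_simps)
qed

end

text \<open>The situation after the local unitaries have been undone, with all normalisations
  absorbed into \<gamma>. Outcomes of probability zero are excluded here and treated
  separately.\<close>

locale W_to_EPR =
  fixes N :: nat and B :: "nat \<Rightarrow> op1" and i j :: nat and \<gamma> :: complex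
  assumes ij: "i \<in> {1..N}" "j \<in> {1..N}" "i \<noteq> j"
    and \<gamma>: "\<gamma> \<noteq> 0"
    and W_EPR: "\<And>x. x \<in> Bits N \<Longrightarrow>
      W_image N B x = (if (\<forall>k. k \<noteq> i \<and> k \<noteq> j \<longrightarrow> \<not> x k) \<and> x i = x j then \<gamma> else 0)"
begin

lemma pair_in_Bits:
  "(\<lambda>m. False) \<in> Bits N" "(\<lambda>m. m = i) \<in> Bits N" "(\<lambda>m. m = j) \<in> Bits N" "(\<lambda>m. m = i \<or> m = j) \<in> Bits N"
  using ij by (auto simp: Bits_def)

lemma W_corners:
  "W_image N B (\<lambda>m. False) = \<gamma>" "W_image N B (\<lambda>m. m = i) = 0"
  "W_image N B (\<lambda>m. m = j) = 0" "W_image N B (\<lambda>m. m = i \<or> m = j) = \<gamma>"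
  unfolding W_EPR[OF pair_in_Bits(1)] W_EPR[OF pair_in_Bits(2)]
    W_EPR[OF pair_in_Bits(3)] W_EPR[OF pair_in_Bits(4)]
  using ij(3) by simp_all

text \<open>Otherwise the amplitudes at the four corners would be proportional to those of a product
  state, which an EPR pair is not.\<close>

lemma spectator_False:
  assumes k: "k \<in> {1..N}" "k \<noteq> i" "k \<noteq> j"
  shows "B k True False = 0"
proof (rule ccontr)
  assume nz: "B k True False \<noteq> 0"
  \<comment> \<open>Minus the determinant of \<open>B k\<close>. Switching bit \<open>k\<close> on
    makes the EPR amplitude vanish; eliminating the common sum \<open>?S\<close> between the two
    values of that bit leaves \<open>D\<close> times a product amplitude.\<close>
  define D where "D = B k False True * B k True False - B k True True * B k False False"
  define R where "R x = (\<Prod>m\<in>{1..N} - {k}. B m (x m) False)" for x :: "nat \<Rightarrow> bool"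
  have step: "W_image N B x * B k True False = D * R x"
    if x: "x \<in> Bits N" "\<not> x k" for x
  proof -
    let ?S = "\<lambda>x. \<Sum>l\<in>{1..N} - {k}. \<Prod>m\<in>{1..N} - {k}. B m (x m) (m = l)"
    have R: "R (x(k := True)) = R x" unfolding R_def by (rule prod.cong) auto
    have S: "?S (x(k := True)) = ?S x" by (intro sum.cong prod.cong) auto
    have "W_image N B (x(k := True)) = 0"
      unfolding W_EPR[OF Bits_update[OF x(1) k(1)]] using k(2,3) by (intro if_not_P) auto
    then have "B k True True * R x + B k True False * ?S x = 0"
      using W_image_split[OF k(1), of B "x(k := True)"] R S by (simp add: R_def)
    moreover have "W_image N B x = B k False True * R x + B k False False * ?S x"
      using W_image_split[OF k(1), of B x] x(2) by (simp add: R_def)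
    ultimately show ?thesis unfolding D_def by algebra
  qed
  \<comment> \<open>The minor of the product amplitudes \<open>R\<close> vanishes, whereas at the
    EPR corners the left side is a nonzero multiple of \<open>\<gamma>\<^sup>2\<close> and the right
    side is 0.\<close>
  have "(W_image N B (\<lambda>m. False) * B k True False) * (W_image N B (\<lambda>m. m = i \<or> m = j) * B k True False)
      = (W_image N B (\<lambda>m. m = i) * B k True False) * (W_image N B (\<lambda>m. m = j) * B k True False)"
    using prod_rectangle[OF ij(3), of "\<lambda>m b. B m b False" "{1..N} - {k}"] k
    by (simp add: step pair_in_Bits R_def)
  then show False using nz \<gamma> by (simp add: W_corners)
qed

text \<open>The coefficient \<open>Q\<close> of the 2x2 estimates: the excitation is inside the pair
  and every spectator takes 0 to 0.\<close>

definition rest_amp :: complex where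
  "rest_amp = (\<Prod>m\<in>{1..N} - {i, j}. B m False False)"

text \<open>The coefficient \<beta>: the excitation enters at a spectator \<open>k\<close>, and all
  spectators still end in 0.\<close>

definition rest_sum :: complex where
  "rest_sum = (\<Sum>k\<in>{1..N} - {i, j}. \<Prod>m\<in>{1..N} - {i, j}. B m False (m = k))"

lemma pair_equation:
  "rest_amp * (B i a True * B j b False + B i a False * B j b True) + rest_sum * (B i a False * B j b False)
    = (if a = b then \<gamma> else 0)"
proof -
  define x where "x = (\<lambda>m. (m = i \<and> a) \<or> (m = j \<and> b))"
  have x: "x \<in> Bits N" "x i = a" "x j = b" "\<And>k. k \<noteq> i \<Longrightarrow> k \<noteq> j \<Longrightarrow> \<not> x k"
    using ij by (auto simp: Bits_def x_def)
  have t: "(\<Prod>m\<in>{1..N}. B m (x m) (m = k)) = B i a (i = k) * B j b (j = k) * (\<Prod>m\<in>{1..N} - {i, j}. B m False (m = k))" for k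
  proof -
    have "(\<Prod>m\<in>{1..N} - {i, j}. B m (x m) (m = k)) = (\<Prod>m\<in>{1..N} - {i, j}. B m False (m = k))"
      by (rule prod.cong) (auto simp: x(4))
    then show ?thesis unfolding prod_split2[OF finite_atLeastAtMost ij] x(2,3) by simp
  qed
  have r: "(\<Prod>m\<in>{1..N} - {i, j}. B m False (m = i)) = rest_amp"
    "(\<Prod>m\<in>{1..N} - {i, j}. B m False (m = j)) = rest_amp"
    unfolding rest_amp_def by (auto intro!: prod.cong)
  have "W_image N B x = B i a True * B j b False * rest_amp + B i a False * B j b True * rest_amp
    + (\<Sum>k\<in>{1..N} - {i, j}. B i a (i = k) * B j b (j = k) * (\<Prod>m\<in>{1..N} - {i, j}. B m False (m = k)))"
    unfolding W_image_def t sum_split2[OF finite_atLeastAtMost ij] using ij(3) r by simp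
  also have "(\<Sum>k\<in>{1..N} - {i, j}. B i a (i = k) * B j b (j = k) * (\<Prod>m\<in>{1..N} - {i, j}. B m False (m = k)))
    = B i a False * B j b False * rest_sum"
    unfolding rest_sum_def sum_distrib_left by (rule sum.cong) auto
  finally have "W_image N B x = rest_amp * (B i a True * B j b False + B i a False * B j b True)
    + rest_sum * (B i a False * B j b False)"
    by (simp add: algebra_simps)
  moreover have "W_image N B x = (if a = b then \<gamma> else 0)"
    unfolding W_EPR[OF x(1)] using x(2-4) by simp
  ultimately show ?thesis by simp
qed

text \<open>By \<open>spectator_False\<close>, the column of a spectator at input 0 has the single
  entry \<open>B k False False\<close>. The spectators therefore contribute exactly the squared
  modulus of \<open>rest_amp\<close>, the same factor as in \<open>pair_equation\<close>.\<close>

lemma norm2_pair: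
  assumes "\<And>k. k \<noteq> i \<Longrightarrow> k \<noteq> j \<Longrightarrow> \<not> y k"
  shows "norm2 N (apply_local N B (basis y))
    = (cmod rest_amp)\<^sup>2 * vnorm2 (\<lambda>b. B i b (y i)) * vnorm2 (\<lambda>b. B j b (y j))"
proof -
  have "k \<in> {1..N}" if "y k" for k
    using assms[of k] that ij by (cases "k = i \<or> k = j") auto
  then have y: "y \<in> Bits N" unfolding Bits_def by blast
  have "norm2 N (apply_local N B (basis y)) = vnorm2 (\<lambda>b. B i b (y i)) * vnorm2 (\<lambda>b. B j b (y j))
    * (\<Prod>k\<in>{1..N} - {i, j}. vnorm2 (\<lambda>b. B k b (y k)))"
    unfolding norm2_apply_basis[OF y] vnorm2_cols prod_split2[OF finite_atLeastAtMost ij] ..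
  also have "(\<Prod>k\<in>{1..N} - {i, j}. vnorm2 (\<lambda>b. B k b (y k))) = (\<Prod>k\<in>{1..N} - {i, j}. (cmod (B k False False))\<^sup>2)"
    using assms by (intro prod.cong) (auto simp: vnorm2_alt spectator_False)
  also have "\<dots> = (cmod rest_amp)\<^sup>2"
    by (simp add: rest_amp_def prod_norm[symmetric] prod_power_distrib)
  finally show ?thesis by (simp add: algebra_simps)
qed

lemma weight_bounds:
  "(cmod \<gamma>)\<^sup>2 \<le> norm2 N (apply_local N B (basis (\<lambda>m. m = i)))"
  "(cmod \<gamma>)\<^sup>2 \<le> norm2 N (apply_local N B (basis (\<lambda>m. m = j)))"
  "((cmod \<gamma>)\<^sup>2)\<^sup>2 \<le> norm2 N (apply_local N B (basis (\<lambda>m. False)))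
      * norm2 N (apply_local N B (basis (\<lambda>m. m = i \<or> m = j)))"
proof -
  note pe = pair_equation
  \<comment> \<open>The equation with the roles of \<open>i\<close> and \<open>j\<close> exchanged,
    which turns the bound at \<open>j\<close> into the one at \<open>i\<close>.\<close>
  have pe': "rest_amp * (B j b True * B i a False + B j b False * B i a True) + rest_sum * (B j b False * B i a False)
    = (if b = a then \<gamma> else 0)" for a b
    using pe[of a b] by (simp add: algebra_simps)
  show "(cmod \<gamma>)\<^sup>2 \<le> norm2 N (apply_local N B (basis (\<lambda>m. m = j)))"
    using weight_le_single[OF pe \<gamma>] ij(3) by (subst norm2_pair) auto
  show "(cmod \<gamma>)\<^sup>2 \<le> norm2 N (apply_local N B (basis (\<lambda>m. m = i)))"
    using weight_le_single[OF pe' \<gamma>] ij(3) by (subst norm2_pair) (auto simp: algebra_simps)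
  show "((cmod \<gamma>)\<^sup>2)\<^sup>2 \<le> norm2 N (apply_local N B (basis (\<lambda>m. False)))
      * norm2 N (apply_local N B (basis (\<lambda>m. m = i \<or> m = j)))"
    using weight_squared_le[OF pe \<gamma>] by (subst (1 2) norm2_pair) auto
qed

end

section \<open>Bounds for a single Kraus operator\<close>

lemma norm2_cong: "(\<And>x. x \<in> Bits N \<Longrightarrow> \<psi> x = \<psi>' x) \<Longrightarrow> norm2 N \<psi> = norm2 N \<psi>'"
  by (simp add: norm2_def)

lemma norm2_nonneg: "norm2 N \<psi> \<ge> 0"
  by (simp add: norm2_def sum_nonneg)

lemma norm2_scale: "norm2 N (\<lambda>x. c * \<psi> x) = (cmod c)\<^sup>2 * norm2 N \<psi>"
  by (simp add: norm2_def norm_mult power_mult_distrib sum_distrib_left)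

lemma norm2_EPR_state:
  assumes ij: "i \<in> {1..N}" "j \<in> {1..N}" "i \<noteq> j"
  shows "norm2 N (EPR_state N i j) = 1"
proof -
  have "(\<lambda>m. m = i \<or> m = j) \<noteq> (\<lambda>m. False)" by metis
  moreover have "x = (\<lambda>m. False) \<or> x = (\<lambda>m. m = i \<or> m = j)" if "\<forall>k. k \<noteq> i \<and> k \<noteq> j \<longrightarrow> \<not> x k" "x i = x j" for x
    using that by (cases "x i") (auto simp: fun_eq_iff)
  moreover have "(\<lambda>m. False) \<in> Bits N" "(\<lambda>m. m = i \<or> m = j) \<in> Bits N"
    using ij by (auto simp: Bits_def)
  ultimately have "norm2 N (EPR_state N i j) = (\<Sum>x\<in>{\<lambda>m. False, \<lambda>m. m = i \<or> m = j}. 1 / 2)"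
    unfolding norm2_def using ij
    by (intro sum.mono_neutral_cong_right) (auto simp: EPR_state_def norm_divide power_divide)
  then show ?thesis
    using \<open>(\<lambda>m. m = i \<or> m = j) \<noteq> (\<lambda>m. False)\<close> by simp
qed

lemma EPR_outcome_bounds:
  assumes ij: "i \<in> {1..N}" "j \<in> {1..N}" "i \<noteq> j"
    and LU: "is_EPR_LU N i j \<phi>"
    and out: "\<And>x. x \<in> Bits N \<Longrightarrow> apply_local N A (W_state N) x = c * \<phi> x"
  defines "P \<equiv> real N / 2 * norm2 N (apply_local N A (W_state N))"
  shows "P \<le> norm2 N (apply_local N A (basis (\<lambda>m. m = i)))"
    and "P \<le> norm2 N (apply_local N A (basis (\<lambda>m. m = j)))"
    and "P\<^sup>2 \<le> norm2 N (apply_local N A (basis (\<lambda>m. False)))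
      * norm2 N (apply_local N A (basis (\<lambda>m. m = i \<or> m = j)))"
proof -
  obtain U where U: "\<And>k. k \<in> {1..N} \<Longrightarrow> unitary2 (U k)"
    and \<phi>: "\<And>x. x \<in> Bits N \<Longrightarrow> \<phi> x = apply_local N U (EPR_state N i j) x"
    using LU unfolding is_EPR_LU_def by blast
  define B where "B = (\<lambda>k. op_comp (adj (U k)) (A k))"
  have N: "N > 0" using ij by auto
  have inv: "norm2 N (apply_local N B \<psi>) = norm2 N (apply_local N A \<psi>)" for \<psi>
    unfolding B_def apply_local_comp[symmetric] using U by (intro norm2_unitary unitary2_adj)
  have "apply_local N B (W_state N) x = c * EPR_state N i j x" if x: "x \<in> Bits N" for x
  proof -
    have "apply_local N B (W_state N) = apply_local N (\<lambda>k. adj (U k)) (\<lambda>x. c * apply_local N U (EPR_state N i j) x)"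
      unfolding B_def apply_local_comp[symmetric] by (rule apply_local_cong) (simp add: out \<phi>)
    also have "\<dots> = (\<lambda>x. c * apply_local N (\<lambda>k. op_comp (adj (U k)) (U k)) (EPR_state N i j) x)"
      by (simp add: apply_local_scale apply_local_comp)
    finally have "apply_local N B (W_state N) x = c * apply_local N (\<lambda>k. op_comp (adj (U k)) (U k)) (EPR_state N i j) x"
      by (rule fun_cong)
    also have "apply_local N (\<lambda>k. op_comp (adj (U k)) (U k)) (EPR_state N i j) x = EPR_state N i j x"
      using x U by (intro apply_local_unit unitary2_adj_comp)
    finally show ?thesis .
  qed
  note EPR = this
  \<comment> \<open>\<open>sqrt N\<close> removes the normalisation of the W state and
    \<open>1 / sqrt 2\<close> is the EPR amplitude, so the squared modulus of \<gamma> is exactly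
    \<open>P\<close>.\<close>
  define \<gamma> where "\<gamma> = complex_of_real (sqrt (real N)) * c * complex_of_real (1 / sqrt 2)"
  have W: "W_image N B x = (if (\<forall>k. k \<noteq> i \<and> k \<noteq> j \<longrightarrow> \<not> x k) \<and> x i = x j then \<gamma> else 0)"
    if x: "x \<in> Bits N" for x
  proof -
    have "W_image N B x = complex_of_real (sqrt (real N)) * apply_local N B (W_state N) x"
      using N by (simp add: apply_local_W[OF x])
    then have 1: "W_image N B x = complex_of_real (sqrt (real N)) * c * EPR_state N i j x"
      by (simp only: EPR[OF x] mult.assoc)
    show ?thesis
    proof (cases "(\<forall>k. k \<noteq> i \<and> k \<noteq> j \<longrightarrow> \<not> x k) \<and> x i = x j")
      case True
      have "EPR_state N i j x = complex_of_real (1 / sqrt 2)"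
        unfolding EPR_state_def by (rule if_P[OF conjI[OF x True]])
      then show ?thesis unfolding 1 \<gamma>_def if_P[OF True] by simp
    next
      case False
      then have "EPR_state N i j x = 0"
        unfolding EPR_state_def by (simp only: simp_thms if_False)
      then show ?thesis unfolding 1 if_not_P[OF False] by simp
    qed
  qed
  have "norm2 N (apply_local N A (W_state N)) = (cmod c)\<^sup>2"
    unfolding inv[symmetric]
    using norm2_cong[OF EPR] by (simp add: norm2_scale norm2_EPR_state[OF ij])
  then have P: "P = (cmod \<gamma>)\<^sup>2"
    by (simp add: P_def \<gamma>_def norm_mult norm_divide power_mult_distrib power_divide)
  show "P \<le> norm2 N (apply_local N A (basis (\<lambda>m. m = i)))"
    and "P \<le> norm2 N (apply_local N A (basis (\<lambda>m. m = j)))"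
    and "P\<^sup>2 \<le> norm2 N (apply_local N A (basis (\<lambda>m. False)))
      * norm2 N (apply_local N A (basis (\<lambda>m. m = i \<or> m = j)))"
  proof (atomize (full), cases "\<gamma> = 0")
    case True
    then show "P \<le> norm2 N (apply_local N A (basis (\<lambda>m. m = i)))
      \<and> P \<le> norm2 N (apply_local N A (basis (\<lambda>m. m = j)))
      \<and> P\<^sup>2 \<le> norm2 N (apply_local N A (basis (\<lambda>m. False)))
        * norm2 N (apply_local N A (basis (\<lambda>m. m = i \<or> m = j)))"
      by (simp add: P norm2_nonneg)
  next
    case False
    then interpret W_to_EPR N B i j \<gamma>
      using ij W by unfold_locales auto
    show "P \<le> norm2 N (apply_local N A (basis (\<lambda>m. m = i)))
      \<and> P \<le> norm2 N (apply_local N A (basis (\<lambda>m. m = j)))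
      \<and> P\<^sup>2 \<le> norm2 N (apply_local N A (basis (\<lambda>m. False)))
        * norm2 N (apply_local N A (basis (\<lambda>m. m = i \<or> m = j)))"
      using weight_bounds unfolding P inv by blast
  qed
qed

section \<open>Necessity\<close>

text \<open>Each outcome has at most one label, so the outcome sets of different edges are
  disjoint.\<close>

lemma sum_labelled_le:
  fixes f :: "'a \<Rightarrow> real"
  assumes "finite L" "finite F" "\<And>l. f l \<ge> 0"
  shows "(\<Sum>e\<in>F. \<Sum>l\<in>{l\<in>L. lab l = Some e}. f l) \<le> (\<Sum>l\<in>L. f l)"
proof -
  have "(\<Sum>e\<in>F. \<Sum>l\<in>{l\<in>L. lab l = Some e}. f l) = (\<Sum>l\<in>(\<Union>e\<in>F. {l\<in>L. lab l = Some e}). f l)"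
    using assms by (subst sum.UNION_disjoint) auto
  also have "\<dots> \<le> (\<Sum>l\<in>L. f l)"
    using assms by (intro sum_mono2) auto
  finally show ?thesis .
qed

text \<open>Cauchy-Schwarz for the square roots of \<open>g\<close> and \<open>h\<close>. It
  combines the bounds of several Kraus operators that carry the same edge.\<close>

lemma sum_squared_le_product:
  fixes w g h :: "'a \<Rightarrow> real"
  assumes "\<And>l. l \<in> S \<Longrightarrow> (w l)\<^sup>2 \<le> g l * h l" "\<And>l. l \<in> S \<Longrightarrow> w l \<ge> 0"
    "\<And>l. l \<in> S \<Longrightarrow> g l \<ge> 0" "\<And>l. l \<in> S \<Longrightarrow> h l \<ge> 0"
  shows "(\<Sum>l\<in>S. w l)\<^sup>2 \<le> (\<Sum>l\<in>S. g l) * (\<Sum>l\<in>S. h l)"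
proof -
  have "(\<Sum>l\<in>S. w l) \<le> (\<Sum>l\<in>S. sqrt (g l) * sqrt (h l))"
    by (intro sum_mono) (simp add: assms(1) real_le_rsqrt flip: real_sqrt_mult)
  then have "(\<Sum>l\<in>S. w l)\<^sup>2 \<le> (\<Sum>l\<in>S. sqrt (g l) * sqrt (h l))\<^sup>2"
    using assms by (intro power_mono sum_nonneg) auto
  also have "\<dots> \<le> (\<Sum>l\<in>S. (sqrt (g l))\<^sup>2) * (\<Sum>l\<in>S. (sqrt (h l))\<^sup>2)"
    by (rule Cauchy_Schwarz_ineq_sum)
  also have "\<dots> = (\<Sum>l\<in>S. g l) * (\<Sum>l\<in>S. h l)"
    using assms by simp
  finally show ?thesis .
qed

lemma distillation_necessary:
  assumes E: "E \<subseteq> {(i, j). 1 \<le> i \<and> i < j \<and> j \<le> N}"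
    and sd: "separable_distillation N (W_state N) E p"
  shows "(real N)\<^sup>2 / 4 * (\<Sum>e\<in>E. (p e)\<^sup>2) \<le> 1"
    and "k \<in> {1..N} \<Longrightarrow> real N / 2 * (\<Sum>e\<in>{e\<in>E. fst e = k \<or> snd e = k}. p e) \<le> 1"
proof -
  have finE: "finite E"
    by (rule finite_subset[of _ "{1..N} \<times> {1..N}"]) (use E in auto)
  obtain L :: "nat set" and A lab where finL: "finite L"
    and K: "\<And>\<chi>. (\<Sum>l\<in>L. norm2 N (apply_local N (A l) \<chi>)) \<le> norm2 N \<chi>"
    and out: "\<And>l e. l \<in> L \<Longrightarrow> lab l = Some e \<Longrightarrow> \<exists>c \<phi>. is_EPR_LU N (fst e) (snd e) \<phi> \<and>
        (\<forall>x\<in>Bits N. apply_local N (A l) (W_state N) x = c * \<phi> x)"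
    and p: "\<And>e. e \<in> E \<Longrightarrow> p e = (\<Sum>l\<in>{l\<in>L. lab l = Some e}. norm2 N (apply_local N (A l) (W_state N)))"
    using sd unfolding separable_distillation_def by blast
  \<comment> \<open>\<open>g y l\<close> is the diagonal entry at \<open>y\<close> contributed by
    outcome \<open>l\<close>; \<open>w l\<close> is its probability in the scale of
    \<open>EPR_outcome_bounds\<close>.\<close>
  define g where "g y l = norm2 N (apply_local N (A l) (basis y))" for y l
  define w where "w l = real N / 2 * norm2 N (apply_local N (A l) (W_state N))" for l
  define S where "S e = {l\<in>L. lab l = Some e}" for e
  have g0: "g y l \<ge> 0" for y l by (simp add: g_def norm2_nonneg)
  have w0: "w l \<ge> 0" for l by (simp add: w_def norm2_nonneg)
  have G: "(\<Sum>l\<in>L. g y l) \<le> 1" if "y \<in> Bits N" for y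
    using K[of "basis y"] that by (simp add: g_def norm2_basis)
  have P: "real N / 2 * p e = (\<Sum>l\<in>S e. w l)" if "e \<in> E" for e
    using p[OF that] by (simp add: S_def w_def sum_distrib_left)
  have bounds: "w l \<le> g (\<lambda>m. m = fst e) l" "w l \<le> g (\<lambda>m. m = snd e) l"
    "(w l)\<^sup>2 \<le> g (\<lambda>m. False) l * g (\<lambda>m. m = fst e \<or> m = snd e) l"
    if "e \<in> E" and l: "l \<in> S e" for e l
  proof -
    have e: "fst e \<in> {1..N}" "snd e \<in> {1..N}" "fst e \<noteq> snd e" using \<open>e \<in> E\<close> E by auto
    obtain c \<phi> where \<phi>: "is_EPR_LU N (fst e) (snd e) \<phi>"
      "\<And>x. x \<in> Bits N \<Longrightarrow> apply_local N (A l) (W_state N) x = c * \<phi> x"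
      using out[of l e] l unfolding S_def by blast
    show "w l \<le> g (\<lambda>m. m = fst e) l" "w l \<le> g (\<lambda>m. m = snd e) l"
      "(w l)\<^sup>2 \<le> g (\<lambda>m. False) l * g (\<lambda>m. m = fst e \<or> m = snd e) l"
      unfolding w_def g_def using EPR_outcome_bounds[OF e \<phi>] by blast+
  qed
  show "real N / 2 * (\<Sum>e\<in>{e\<in>E. fst e = k \<or> snd e = k}. p e) \<le> 1" if k: "k \<in> {1..N}"
  proof -
    let ?Ek = "{e\<in>E. fst e = k \<or> snd e = k}"
    have "real N / 2 * (\<Sum>e\<in>?Ek. p e) = (\<Sum>e\<in>?Ek. \<Sum>l\<in>S e. w l)"
      unfolding sum_distrib_left by (intro sum.cong refl P) simp
    also have "\<dots> \<le> (\<Sum>e\<in>?Ek. \<Sum>l\<in>S e. g (\<lambda>m. m = k) l)"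
      using bounds by (intro sum_mono) auto
    also have "\<dots> \<le> (\<Sum>l\<in>L. g (\<lambda>m. m = k) l)"
      unfolding S_def using finL finE g0 by (intro sum_labelled_le) auto
    also have "\<dots> \<le> 1" by (rule G[OF Bits_single[OF k]])
    finally show ?thesis .
  qed
  have "(real N)\<^sup>2 / 4 * (\<Sum>e\<in>E. (p e)\<^sup>2) = (\<Sum>e\<in>E. (\<Sum>l\<in>S e. w l)\<^sup>2)"
    unfolding sum_distrib_left
    by (rule sum.cong) (simp_all add: P[symmetric] power_mult_distrib power_divide)
  also have "\<dots> \<le> (\<Sum>e\<in>E. \<Sum>l\<in>S e. g (\<lambda>m. False) l)"
  proof (rule sum_mono)
    \<comment> \<open>The entries at the doubly excited string of \<open>e\<close> sum to at most 1,
      so only those at the unexcited string remain. That string is shared by all edges, hence the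
      single quadratic condition.\<close>
    fix e assume e: "e \<in> E"
    let ?y = "\<lambda>m. m = fst e \<or> m = snd e"
    have "?y \<in> Bits N" using e E by (auto simp: Bits_def)
    moreover have "(\<Sum>l\<in>S e. g ?y l) \<le> (\<Sum>l\<in>L. g ?y l)"
      using finL g0 by (intro sum_mono2) (auto simp: S_def)
    ultimately have 1: "(\<Sum>l\<in>S e. g ?y l) \<le> 1" using G[of ?y] by linarith
    have "(\<Sum>l\<in>S e. w l)\<^sup>2 \<le> (\<Sum>l\<in>S e. g (\<lambda>m. False) l) * (\<Sum>l\<in>S e. g ?y l)"
      using bounds[OF e] w0 g0 by (intro sum_squared_le_product)
    also have "\<dots> \<le> (\<Sum>l\<in>S e. g (\<lambda>m. False) l)"
      by (rule mult_left_le[OF 1]) (simp add: sum_nonneg g0)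
    finally show "(\<Sum>l\<in>S e. w l)\<^sup>2 \<le> (\<Sum>l\<in>S e. g (\<lambda>m. False) l)" .
  qed
  also have "\<dots> \<le> (\<Sum>l\<in>L. g (\<lambda>m. False) l)"
    unfolding S_def using finL finE g0 by (intro sum_labelled_le) auto
  also have "\<dots> \<le> 1" by (rule G) (simp add: Bits_def)
  finally show "(real N)\<^sup>2 / 4 * (\<Sum>e\<in>E. (p e)\<^sup>2) \<le> 1" .
qed

section \<open>Sufficiency\<close>

definition pair_diag :: "nat \<Rightarrow> nat \<Rightarrow> real \<Rightarrow> nat \<Rightarrow> bool \<Rightarrow> complex" where
  "pair_diag i j P k b = (if k = i \<or> k = j then (if b then 1 else complex_of_real (sqrt P))
     else (if b then 0 else 1))"

definition pair_kraus :: "nat \<Rightarrow> nat \<Rightarrow> real \<Rightarrow> nat \<Rightarrow> op1" where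
  "pair_kraus i j P k a b = (if a = b then pair_diag i j P k a else 0)"

text \<open>For \<open>P \<ge> 0\<close>, the diagonal of \<open>K\<^sup>\<dagger>K\<close> for
  \<open>K\<close> the tensor product of the \<open>pair_kraus i j P k\<close>.\<close>

definition pair_weight :: "nat \<Rightarrow> nat \<Rightarrow> real \<Rightarrow> (nat \<Rightarrow> bool) \<Rightarrow> real" where
  "pair_weight i j P x = (if \<forall>k. k \<noteq> i \<and> k \<noteq> j \<longrightarrow> \<not> x k
     then (if x i then 1 else P) * (if x j then 1 else P) else 0)"

lemma prod_pair_diag:
  assumes "i \<in> {1..N}" "j \<in> {1..N}" "i \<noteq> j" "x \<in> Bits N"
  shows "(\<Prod>k\<in>{1..N}. pair_diag i j P k (x k)) = (if \<forall>k. k \<noteq> i \<and> k \<noteq> j \<longrightarrow> \<not> x k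
     then (if x i then 1 else complex_of_real (sqrt P)) * (if x j then 1 else complex_of_real (sqrt P)) else 0)"
proof (cases "\<forall>k. k \<noteq> i \<and> k \<noteq> j \<longrightarrow> \<not> x k")
  case True
  have "(\<Prod>k\<in>{1..N} - {i, j}. pair_diag i j P k (x k)) = 1"
    using True by (intro prod.neutral) (auto simp: pair_diag_def)
  then show ?thesis
    unfolding prod_split2[OF finite_atLeastAtMost assms(1-3)] if_P[OF True] by (simp add: pair_diag_def)
next
  case False
  then obtain k where k: "k \<noteq> i" "k \<noteq> j" "x k" by blast
  then have "k \<in> {1..N}" "pair_diag i j P k (x k) = 0"
    using assms(4) unfolding Bits_def pair_diag_def by auto
  then have "(\<Prod>k\<in>{1..N}. pair_diag i j P k (x k)) = 0"
    by (intro prod_zero bexI[of _ k]) auto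
  then show ?thesis unfolding if_not_P[OF False] .
qed

lemma apply_pair_kraus:
  "x \<in> Bits N \<Longrightarrow> apply_local N (pair_kraus i j P) \<psi> x = (\<Prod>k\<in>{1..N}. pair_diag i j P k (x k)) * \<psi> x"
  unfolding pair_kraus_def[abs_def] by (rule apply_local_diag)

lemma norm2_pair_kraus:
  assumes "i \<in> {1..N}" "j \<in> {1..N}" "i \<noteq> j" "P \<ge> 0"
  shows "norm2 N (apply_local N (pair_kraus i j P) \<psi>) = (\<Sum>x\<in>Bits N. pair_weight i j P x * (cmod (\<psi> x))\<^sup>2)"
  unfolding norm2_def
proof (rule sum.cong)
  fix x assume x: "x \<in> Bits N"
  have "(cmod (\<Prod>k\<in>{1..N}. pair_diag i j P k (x k)))\<^sup>2 = pair_weight i j P x"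
  proof (cases "\<forall>k. k \<noteq> i \<and> k \<noteq> j \<longrightarrow> \<not> x k")
    case True
    show ?thesis
      unfolding prod_pair_diag[OF assms(1-3) x] pair_weight_def if_P[OF True]
      using assms(4) by (simp add: norm_mult power_mult_distrib)
  next
    case False
    show ?thesis
      unfolding prod_pair_diag[OF assms(1-3) x] pair_weight_def if_not_P[OF False] by simp
  qed
  then show "(cmod (apply_local N (pair_kraus i j P) \<psi> x))\<^sup>2 = pair_weight i j P x * (cmod (\<psi> x))\<^sup>2"
    by (simp only: apply_pair_kraus[OF x] norm_mult power_mult_distrib)
qed simp

text \<open>Pauli X at party \<open>i\<close>, identity elsewhere. It turns
  \<open>|00> + |11>\<close> into the \<open>|01> + |10>\<close> left over from the W state.\<close>

definition flip_at :: "nat \<Rightarrow> nat \<Rightarrow> op1" where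
  "flip_at i k a b = (if (k = i) = (a \<noteq> b) then 1 else 0)"

lemma unitary2_flip: "unitary2 (flip_at i k)"
proof -
  have "(\<Sum>b\<in>UNIV. cnj (flip_at i k b a) * flip_at i k b a') = (if a = a' then 1 else 0)" for a a'
    by (cases "k = i"; cases a; cases a') (simp_all add: flip_at_def UNIV_bool)
  then show ?thesis by (simp add: unitary2_def)
qed

lemma apply_flip:
  assumes "i \<in> {1..N}" "x \<in> Bits N"
  shows "apply_local N (flip_at i) \<psi> x = \<psi> (x(i := \<not> x i))"
proof -
  let ?x = "x(i := \<not> x i)"
  have x': "?x \<in> Bits N" using assms by (intro Bits_update)
  have "flip_at i k (x k) b = (if ?x k = b then 1 else 0)" for k b
    by (auto simp: flip_at_def)
  then have "apply_local N (flip_at i) \<psi> x = (\<Sum>y\<in>Bits N. (\<Prod>k\<in>{1..N}. if ?x k = y k then 1 else 0) * \<psi> y)"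
    using assms(2) by (simp only: apply_local_def if_True)
  also have "\<dots> = (\<Sum>y\<in>Bits N. if ?x = y then \<psi> ?x else 0)"
    using x' by (intro sum.cong refl) (subst prod_delta_Bits, auto)
  finally show ?thesis using x' by simp
qed

text \<open>Only the terms excited at \<open>i\<close> or \<open>j\<close> survive, and each is
  damped once, at the unexcited end. The amplitude \<open>sqrt (P / N)\<close> equals
  \<open>sqrt (2 * P / N)\<close> times the EPR amplitude \<open>1 / sqrt 2\<close>.\<close>

lemma pair_kraus_W:
  assumes ij: "i \<in> {1..N}" "j \<in> {1..N}" "i \<noteq> j" and "P \<ge> 0" and x: "x \<in> Bits N"
  shows "apply_local N (pair_kraus i j P) (W_state N) x
    = complex_of_real (sqrt (2 * P / real N)) * apply_local N (flip_at i) (EPR_state N i j) x"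
proof -
  have x': "x(i := \<not> x i) \<in> Bits N" using x ij by (intro Bits_update)
  consider (out) k where "k \<noteq> i" "k \<noteq> j" "x k"
    | (same) "\<forall>k. k \<noteq> i \<and> k \<noteq> j \<longrightarrow> \<not> x k" "x i = x j"
    | (diff) "\<forall>k. k \<noteq> i \<and> k \<noteq> j \<longrightarrow> \<not> x k" "x i \<noteq> x j" by blast
  then show ?thesis
  proof cases
    case out
    then have n: "\<not> (\<forall>k. k \<noteq> i \<and> k \<noteq> j \<longrightarrow> \<not> x k)" by blast
    have "EPR_state N i j (x(i := \<not> x i)) = 0"
      using out by (auto simp: EPR_state_def)
    then show ?thesis
      unfolding apply_pair_kraus[OF x] prod_pair_diag[OF ij x] if_not_P[OF n] apply_flip[OF ij(1) x] by simp
  next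
    case same
    have "x \<noteq> (\<lambda>m. m = k)" for k
      using same(1)[THEN spec[of _ k]] same(2) ij(3) by (cases "k = i \<or> k = j") auto
    then have "W_state N x = 0"
      using W_support[OF x] by (simp add: W_state_def)
    moreover have "EPR_state N i j (x(i := \<not> x i)) = 0"
      using same(2) ij(3) by (simp add: EPR_state_def)
    ultimately show ?thesis
      unfolding apply_pair_kraus[OF x] apply_flip[OF ij(1) x] by simp
  next
    case diff
    have "x = (\<lambda>m. m = i) \<or> x = (\<lambda>m. m = j)"
      using diff by (cases "x i") (auto simp: fun_eq_iff)
    then have "W_state N x = complex_of_real (1 / sqrt (real N))"
      using W_support[OF x] ij x unfolding W_state_def by auto
    moreover have "EPR_state N i j (x(i := \<not> x i)) = complex_of_real (1 / sqrt 2)"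
      using diff ij(3) x' by (simp add: EPR_state_def)
    moreover have "(\<Prod>k\<in>{1..N}. pair_diag i j P k (x k)) = complex_of_real (sqrt P)"
      unfolding prod_pair_diag[OF ij x] if_P[OF diff(1)] using diff(2) by auto
    moreover have "sqrt P * (1 / sqrt (real N)) = sqrt (2 * P / real N) * (1 / sqrt 2)"
      by (simp add: real_sqrt_mult real_sqrt_divide)
    ultimately show ?thesis
      unfolding apply_pair_kraus[OF x] apply_flip[OF ij(1) x] by (simp only: of_real_mult[symmetric])
  qed
qed

lemma norm2_pair_kraus_W:
  assumes ij: "i \<in> {1..N}" "j \<in> {1..N}" "i \<noteq> j" and "P \<ge> 0"
  shows "norm2 N (apply_local N (pair_kraus i j P) (W_state N)) = 2 * P / real N"
proof -
  have "norm2 N (apply_local N (pair_kraus i j P) (W_state N))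
    = norm2 N (\<lambda>x. complex_of_real (sqrt (2 * P / real N)) * apply_local N (flip_at i) (EPR_state N i j) x)"
    using assms by (intro norm2_cong pair_kraus_W)
  also have "\<dots> = 2 * P / real N"
    using assms(4) by (simp add: norm2_scale norm2_unitary unitary2_flip norm2_EPR_state[OF ij])
  finally show ?thesis .
qed

text \<open>The diagonal of the Kraus sum, by number of excitations: none gives the quadratic
  condition, one gives the vertex condition, and more leave at most one edge.\<close>

lemma sum_pair_weight_le:
  assumes E: "E \<subseteq> {(i, j). 1 \<le> i \<and> i < j \<and> j \<le> N}"
    and sq: "(\<Sum>e\<in>E. (P e)\<^sup>2) \<le> 1"
    and deg: "\<And>k. k \<in> {1..N} \<Longrightarrow> (\<Sum>e\<in>{e\<in>E. fst e = k \<or> snd e = k}. P e) \<le> 1"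
    and x: "x \<in> Bits N"
  shows "(\<Sum>e\<in>E. pair_weight (fst e) (snd e) (P e) x) \<le> (1::real)"
proof -
  have finE: "finite E"
    by (rule finite_subset[of _ "{1..N} \<times> {1..N}"]) (use E in auto)
  consider (zero) "x = (\<lambda>m. False)" | (one) k where "x = (\<lambda>m. m = k)"
    | (two) a b where "a < b" "x a" "x b"
  proof (cases "\<exists>a. x a")
    case True
    then obtain a where a: "x a" by blast
    show thesis
    proof (cases "\<exists>b. b \<noteq> a \<and> x b")
      case True
      then obtain b where "b \<noteq> a" "x b" by blast
      then show thesis using a two[of a b] two[of b a] by (meson nat_neq_iff)
    next
      case False
      then have "x = (\<lambda>m. m = a)" using a by (auto simp: fun_eq_iff)
      then show thesis by (rule one)
    qed
  next
    case False
    then show thesis using zero by blast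
  qed
  then show ?thesis
  proof cases
    case zero
    then show ?thesis using sq by (simp add: pair_weight_def power2_eq_square)
  next
    case one
    have k: "k \<in> {1..N}" using x unfolding one Bits_def by blast
    have "pair_weight (fst e) (snd e) (P e) x = (if fst e = k \<or> snd e = k then P e else 0)" if "e \<in> E" for e
    proof -
      have "fst e \<noteq> snd e" using that E by auto
      moreover have "(\<forall>m. m \<noteq> fst e \<and> m \<noteq> snd e \<longrightarrow> m \<noteq> k) \<longleftrightarrow> fst e = k \<or> snd e = k"
        by metis
      ultimately show ?thesis unfolding one pair_weight_def by auto
    qed
    then have "(\<Sum>e\<in>E. pair_weight (fst e) (snd e) (P e) x) = (\<Sum>e\<in>E. if fst e = k \<or> snd e = k then P e else 0)"
      by (rule sum.cong[OF refl])
    also have "\<dots> = (\<Sum>e\<in>{e\<in>E. fst e = k \<or> snd e = k}. P e)"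
      using finE by (simp add: sum.inter_filter)
    also have "\<dots> \<le> 1" by (rule deg[OF k])
    finally show ?thesis .
  next
    case two
    \<comment> \<open>Every excited party must be an end of an edge of nonzero weight. As edges are
      stored in increasing order, \<open>a < b\<close> leaves only \<open>(a, b)\<close>.\<close>
    have "pair_weight (fst e) (snd e) (P e) x \<le> (if e = (a, b) then 1 else 0)" if "e \<in> E" for e
    proof (cases "\<forall>k. k \<noteq> fst e \<and> k \<noteq> snd e \<longrightarrow> \<not> x k")
      case True
      have "fst e < snd e" using that E by auto
      moreover have "a = fst e \<or> a = snd e" "b = fst e \<or> b = snd e" using True two by blast+
      ultimately have "a = fst e" "b = snd e" using two(1) by auto
      then show ?thesis unfolding pair_weight_def using two by (auto simp: prod_eq_iff)
    next
      case False
      then show ?thesis unfolding pair_weight_def if_not_P[OF False] by simp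
    qed
    then have "(\<Sum>e\<in>E. pair_weight (fst e) (snd e) (P e) x) \<le> (\<Sum>e\<in>E. if e = (a, b) then 1 else 0)"
      by (rule sum_mono)
    also have "\<dots> \<le> 1" using finE by simp
    finally show ?thesis .
  qed
qed

lemma distillation_sufficient:
  assumes E: "E \<subseteq> {(i, j). 1 \<le> i \<and> i < j \<and> j \<le> N}"
    and p0: "\<And>e. e \<in> E \<Longrightarrow> p e \<ge> 0"
    and sq: "(real N)\<^sup>2 / 4 * (\<Sum>e\<in>E. (p e)\<^sup>2) \<le> 1"
    and deg: "\<And>k. k \<in> {1..N} \<Longrightarrow> real N / 2 * (\<Sum>e\<in>{e\<in>E. fst e = k \<or> snd e = k}. p e) \<le> 1"
  shows "separable_distillation N (W_state N) E p"
proof -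
  have finE: "finite E"
    by (rule finite_subset[of _ "{1..N} \<times> {1..N}"]) (use E in auto)
  have e: "fst e \<in> {1..N}" "snd e \<in> {1..N}" "fst e \<noteq> snd e" if "e \<in> E" for e
    using that E by auto
  define P where "P e = real N / 2 * p e" for e
  have P0: "P e \<ge> 0" if "e \<in> E" for e using p0[OF that] by (simp add: P_def)
  have sqP: "(\<Sum>e\<in>E. (P e)\<^sup>2) \<le> 1"
    using sq by (simp add: P_def power_mult_distrib power_divide sum_distrib_left)
  have degP: "(\<Sum>e\<in>{e\<in>E. fst e = k \<or> snd e = k}. P e) \<le> 1" if "k \<in> {1..N}" for k
    using deg[OF that] by (simp add: P_def sum_distrib_left)
  define K where "K e = pair_kraus (fst e) (snd e) (P e)" for e
  \<comment> \<open>Outcomes are indexed by natural numbers, so edges are encoded by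
    \<open>prod_encode\<close>. Each listed outcome is a success; failure is the slack in the
    operator inequality.\<close>
  define A where "A = (\<lambda>l. K (prod_decode l))"
  define lab where "lab = (\<lambda>l. Some (prod_decode l))"
  define L where "L = prod_encode ` E"
  have inj: "inj_on prod_encode E" by (rule inj_prod_encode)
  have "(\<Sum>l\<in>L. norm2 N (apply_local N (A l) \<chi>)) \<le> norm2 N \<chi>" for \<chi>
  proof -
    have "(\<Sum>l\<in>L. norm2 N (apply_local N (A l) \<chi>)) = (\<Sum>e\<in>E. norm2 N (apply_local N (K e) \<chi>))"
      unfolding L_def A_def sum.reindex[OF inj] by simp
    also have "\<dots> = (\<Sum>e\<in>E. \<Sum>x\<in>Bits N. pair_weight (fst e) (snd e) (P e) x * (cmod (\<chi> x))\<^sup>2)"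
      unfolding K_def by (intro sum.cong refl norm2_pair_kraus e P0)
    also have "\<dots> = (\<Sum>x\<in>Bits N. (\<Sum>e\<in>E. pair_weight (fst e) (snd e) (P e) x) * (cmod (\<chi> x))\<^sup>2)"
      by (subst sum.swap) (simp add: sum_distrib_right)
    also have "\<dots> \<le> (\<Sum>x\<in>Bits N. 1 * (cmod (\<chi> x))\<^sup>2)"
      by (intro sum_mono mult_right_mono sum_pair_weight_le[OF E sqP degP]) auto
    finally show ?thesis by (simp add: norm2_def)
  qed
  moreover have "e \<in> E \<and> (\<exists>c \<phi>. is_EPR_LU N (fst e) (snd e) \<phi> \<and>
      (\<forall>x\<in>Bits N. apply_local N (A l) (W_state N) x = c * \<phi> x))"
    if "l \<in> L" "lab l = Some e" for l e
  proof -
    have eE: "e \<in> E" and A: "A l = K e"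
      using that by (auto simp: L_def lab_def A_def)
    have "is_EPR_LU N (fst e) (snd e) (apply_local N (flip_at (fst e)) (EPR_state N (fst e) (snd e)))"
      unfolding is_EPR_LU_def using unitary2_flip by blast
    moreover have "\<forall>x\<in>Bits N. apply_local N (A l) (W_state N) x = complex_of_real (sqrt (2 * P e / real N))
        * apply_local N (flip_at (fst e)) (EPR_state N (fst e) (snd e)) x"
      unfolding A K_def using pair_kraus_W[OF e[OF eE] P0[OF eE]] by blast
    ultimately show ?thesis using eE by blast
  qed
  moreover have "p e = (\<Sum>l\<in>{l\<in>L. lab l = Some e}. norm2 N (apply_local N (A l) (W_state N)))" if eE: "e \<in> E" for e
  proof -
    have "{l\<in>L. lab l = Some e} = {prod_encode e}"
      using eE by (auto simp: L_def lab_def)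
    moreover have "N > 0" using e[OF eE] by auto
    ultimately show ?thesis
      using norm2_pair_kraus_W[OF e[OF eE] P0[OF eE]] by (simp add: A_def K_def) (simp add: P_def)
  qed
  moreover have "finite L" using finE by (simp add: L_def)
  ultimately show ?thesis unfolding separable_distillation_def by blast
qed

theorem theorem1:
  fixes N :: nat and E :: "(nat \<times> nat) set" and p :: "nat \<times> nat \<Rightarrow> real"
  assumes "N \<ge> 3"
    and "E \<subseteq> {(i, j). 1 \<le> i \<and> i < j \<and> j \<le> N}"
    and "\<forall>e\<in>E. p e > 0"
  shows "separable_distillation N (W_state N) E p \<longleftrightarrow>
           ((real N)\<^sup>2 / 4 * (\<Sum>e\<in>E. (p e)\<^sup>2) \<le> 1 \<and>
            (\<forall>k\<in>{1..N}. real N / 2 * (\<Sum>e\<in>{e\<in>E. fst e = k \<or> snd e = k}. p e) \<le> 1))"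
proof
  assume "separable_distillation N (W_state N) E p"
  from distillation_necessary[OF assms(2) this]
  show "(real N)\<^sup>2 / 4 * (\<Sum>e\<in>E. (p e)\<^sup>2) \<le> 1 \<and>
      (\<forall>k\<in>{1..N}. real N / 2 * (\<Sum>e\<in>{e\<in>E. fst e = k \<or> snd e = k}. p e) \<le> 1)"
    by blast
next
  assume "(real N)\<^sup>2 / 4 * (\<Sum>e\<in>E. (p e)\<^sup>2) \<le> 1 \<and>
      (\<forall>k\<in>{1..N}. real N / 2 * (\<Sum>e\<in>{e\<in>E. fst e = k \<or> snd e = k}. p e) \<le> 1)"
  then show "separable_distillation N (W_state N) E p"
    using assms(2,3) by (intro distillation_sufficient) (auto intro: less_imp_le)
qed

end
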